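(* For real numbers $x_1,x_2,\dots,x_n$ with $x_1+x_2+\cdots+x_n=0$, we have $$\frac{1}{n!}\sum_{\sigma}\max_{1\le k\le n}\left\{\frac{1}{k}\sum_{i=1}^k x_{\sigma(i)}\right\}^2\le\frac{4}{n}\sum_{i=1}^n x_i^2,$$ where the sum is taken over all permutations $\sigma$ of $\{1,\dots,n\}$.
   Context: The $x_i$ need not be distinct; $n\ge 1$. *)

theory Defs
  imports Complex_Main "HOL-Combinatorics.Permutations"
begin

end

theory Submission
  imports Defs
begin

text \<open>
  Read in the order \<open>k = n, n - 1, \<dots>, 1\<close>, the sample means of a uniformly random permutation form
  a martingale, because exchanging position \<open>k + 1\<close> with a uniformly chosen position \<open>j \<le> k + 1\<close>
  fixes the means with index greater than \<open>k\<close> and averages the \<open>k\<close>-th mean to the \<open>(k + 1)\<close>-st.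
  The statement is Doob's \<open>L\<^sup>2\<close> maximal inequality for this martingale. It is obtained from the
  observation that, with \<open>m k\<close> the absolute mean and \<open>A k\<close> the maximum of \<open>m k, \<dots>, m n\<close>,
  the expectation of \<open>(A k)\<^sup>2 - 2 * m k * A k\<close> can only decrease when \<open>k\<close> does.
\<close>

definition mean :: "(nat \<Rightarrow> real) \<Rightarrow> nat \<Rightarrow> real" where
  "mean y k = (\<Sum>i=1..k. y i) / real k"

definition tail_max :: "nat \<Rightarrow> (nat \<Rightarrow> real) \<Rightarrow> nat \<Rightarrow> real" where
  "tail_max n y k = (MAX j\<in>{k..n}. \<bar>mean y j\<bar>)"

lemma sum_comp_permutes:
  fixes y :: "'a \<Rightarrow> 'b::comm_monoid_add"
  assumes "p permutes S"
  shows "(\<Sum>i\<in>S. y (p i)) = sum y S"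
  using sum.permute[OF assms, of y] by (simp add: o_def)

lemma mean_comp_permutes:
  assumes "p permutes {1..l}" "l \<le> k"
  shows "mean (y \<circ> p) k = mean y k"
proof -
  have "p permutes {1..k}"
    using assms by (auto intro: permutes_subset)
  then show ?thesis
    by (simp add: mean_def sum_comp_permutes)
qed

text \<open>Only means of index at least \<open>k\<close> enter, and their partial sums cannot see a
  rearrangement of the first \<open>k\<close> positions.\<close>

lemma tail_max_comp_permutes:
  assumes "p permutes {1..k}"
  shows "tail_max n (y \<circ> p) k = tail_max n y k"
  unfolding tail_max_def using mean_comp_permutes[OF assms]
  by (intro arg_cong[where f = Max] image_cong) auto

text \<open>After the swap the first \<open>k\<close> positions hold the first \<open>k + 1\<close>
  values except \<open>y j\<close>. Over all \<open>j\<close> each value is left out exactly once,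
  hence counted \<open>k\<close> times.\<close>

lemma sum_mean_transpose:
  assumes "k \<ge> 1"
  shows "(\<Sum>j=1..Suc k. mean (y \<circ> transpose j (Suc k)) k) = real (Suc k) * mean y (Suc k)"
proof -
  let ?S = "\<Sum>i=1..Suc k. y i"
  have "mean (y \<circ> transpose j (Suc k)) k = (?S - y j) / real k" if "j \<in> {1..Suc k}" for j
  proof -
    have "transpose j (Suc k) permutes {1..Suc k}"
      using that by (intro permutes_swap_id) auto
    then have "(\<Sum>i=1..Suc k. y (transpose j (Suc k) i)) = ?S"
      by (rule sum_comp_permutes)
    then show ?thesis
      by (simp add: mean_def)
  qed
  then have "(\<Sum>j=1..Suc k. mean (y \<circ> transpose j (Suc k)) k) = (\<Sum>j=1..Suc k. (?S - y j) / real k)"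
    by (intro sum.cong) auto
  also have "\<dots> = (real (Suc k) * ?S - ?S) / real k"
    by (simp only: sum_divide_distrib[symmetric] sum_subtractf sum_constant card_atLeastAtMost) simp
  also have "\<dots> = ?S"
    using assms by (simp add: distrib_right del: sum.cl_ivl_Suc)
  also have "\<dots> = real (Suc k) * mean y (Suc k)"
    by (simp add: mean_def del: of_nat_Suc sum.cl_ivl_Suc)
  finally show ?thesis .
qed

lemma abs_mean_le_tail_max:
  assumes "k \<le> j" "j \<le> n"
  shows "\<bar>mean y j\<bar> \<le> tail_max n y k"
  unfolding tail_max_def using assms by (intro Max_ge) auto

lemma tail_max_rec:
  assumes "k < n"
  shows "tail_max n y k = max \<bar>mean y k\<bar> (tail_max n y (Suc k))"
proof -
  have "{k..n} = insert k {Suc k..n}"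
    using assms by auto
  then show ?thesis
    using assms by (simp add: tail_max_def)
qed

text \<open>This is the submartingale property of the absolute means, tested against the nonnegative
  weight \<open>tail_max\<close> at \<open>Suc k\<close>, which is determined by the means of index
  above \<open>k\<close>.\<close>

lemma sum_tail_max_mono:
  assumes "1 \<le> k" "k < n"
  shows "(\<Sum>p | p permutes {1..n}. tail_max n (x \<circ> p) (Suc k) * \<bar>mean (x \<circ> p) (Suc k)\<bar>)
    \<le> (\<Sum>p | p permutes {1..n}. tail_max n (x \<circ> p) (Suc k) * \<bar>mean (x \<circ> p) k\<bar>)"
    (is "?L \<le> ?R")
proof -
  let ?P = "{p. p permutes {1..n}}"
  let ?t = "\<lambda>j. transpose j (Suc k)"
  have t: "?t j permutes {1..Suc k}" if "j \<in> {1..Suc k}" for j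
    using that by (intro permutes_swap_id) auto
  \<comment> \<open>Composing with \<open>?t j\<close> only reindexes the sum over permutations and
    leaves the weight unchanged, so \<open>?R\<close> may be averaged over all
    \<open>j\<close>.\<close>
  have R: "?R = (\<Sum>p\<in>?P. tail_max n (x \<circ> p) (Suc k) * \<bar>mean (x \<circ> p \<circ> ?t j) k\<bar>)"
    if j: "j \<in> {1..Suc k}" for j
  proof -
    have "?t j permutes {1..n}"
      using t[OF j] assms by (auto intro: permutes_subset)
    from sum_permutations_compose_right[OF this,
        of "\<lambda>p. tail_max n (x \<circ> p) (Suc k) * \<bar>mean (x \<circ> p) k\<bar>"]
    show ?thesis
      by (simp add: tail_max_comp_permutes[OF t[OF j]] o_assoc)
  qed
  have "real (Suc k) * ?L
      = (\<Sum>p\<in>?P. tail_max n (x \<circ> p) (Suc k) * \<bar>\<Sum>j=1..Suc k. mean (x \<circ> p \<circ> ?t j) k\<bar>)"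
    unfolding sum_mean_transpose[OF assms(1)]
    by (simp add: sum_distrib_left abs_mult mult_ac del: of_nat_Suc)
  also have "\<dots> \<le> (\<Sum>p\<in>?P. tail_max n (x \<circ> p) (Suc k) * (\<Sum>j=1..Suc k. \<bar>mean (x \<circ> p \<circ> ?t j) k\<bar>))"
  proof (intro sum_mono mult_left_mono sum_abs)
    fix p
    show "0 \<le> tail_max n (x \<circ> p) (Suc k)"
      using abs_mean_le_tail_max[of "Suc k" "Suc k" n "x \<circ> p"] assms by linarith
  qed
  also have "\<dots> = (\<Sum>j=1..Suc k. \<Sum>p\<in>?P. tail_max n (x \<circ> p) (Suc k) * \<bar>mean (x \<circ> p \<circ> ?t j) k\<bar>)"
    unfolding sum_distrib_left by (rule sum.swap)
  also have "\<dots> = (\<Sum>j=1..Suc k. ?R)"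
    by (rule sum.cong[OF refl], rule R[symmetric])
  also have "\<dots> = real (Suc k) * ?R"
    by simp
  finally show ?thesis
    by (simp del: of_nat_Suc)
qed

lemma sum_tail_max_square_le:
  assumes "1 \<le> k" "k \<le> n"
  shows "(\<Sum>p | p permutes {1..n}. (tail_max n (x \<circ> p) k)\<^sup>2)
    \<le> 2 * (\<Sum>p | p permutes {1..n}. tail_max n (x \<circ> p) k * \<bar>mean (x \<circ> p) k\<bar>)"
  using assms(2,1)
proof (induction k rule: inc_induct)
  case base
  show ?case
    by (simp add: tail_max_def power2_eq_square sum_nonneg)
next
  case (step k)
  let ?P = "{p. p permutes {1..n}}"
  let ?A = "\<lambda>p. tail_max n (x \<circ> p)"
  let ?m = "\<lambda>p k. \<bar>mean (x \<circ> p) k\<bar>"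
  \<comment> \<open>The quadratic \<open>t * t - 2 * t * m\<close> is smallest at
    \<open>t = m\<close>. Passing from \<open>Suc k\<close> to \<open>k\<close> either keeps the
    maximum or moves it to exactly this minimiser, \<open>m = ?m p k\<close>.\<close>
  have "(?A p k)\<^sup>2 - 2 * (?A p k * ?m p k)
      \<le> (?A p (Suc k))\<^sup>2 - 2 * (?A p (Suc k) * ?m p k)" for p
  proof (cases "?m p k \<le> ?A p (Suc k)")
    case False
    have "0 \<le> (?m p k - ?A p (Suc k))\<^sup>2"
      by simp
    then show ?thesis
      using False tail_max_rec[OF step.hyps(2), of "x \<circ> p"]
      by (simp add: power2_eq_square algebra_simps)
  qed (use tail_max_rec[OF step.hyps(2), of "x \<circ> p"] in simp)
  then have "(\<Sum>p\<in>?P. (?A p k)\<^sup>2 - 2 * (?A p k * ?m p k))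
      \<le> (\<Sum>p\<in>?P. (?A p (Suc k))\<^sup>2 - 2 * (?A p (Suc k) * ?m p k))"
    by (rule sum_mono)
  then have "(\<Sum>p\<in>?P. (?A p k)\<^sup>2) - 2 * (\<Sum>p\<in>?P. ?A p k * ?m p k)
      \<le> (\<Sum>p\<in>?P. (?A p (Suc k))\<^sup>2) - 2 * (\<Sum>p\<in>?P. ?A p (Suc k) * ?m p k)"
    by (simp only: sum_subtractf sum_distrib_left)
  moreover have "(\<Sum>p\<in>?P. (?A p (Suc k))\<^sup>2) \<le> 2 * (\<Sum>p\<in>?P. ?A p (Suc k) * ?m p (Suc k))"
    using step.prems by (intro step.IH) simp
  ultimately show ?case
    using sum_tail_max_mono[OF step.prems step.hyps(2), of x] by linarith
qed

text \<open>By symmetry the left sum is the same for every position \<open>a\<close>; summed over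
  all positions, each permutation contributes \<open>sum f S\<close>.\<close>

lemma sum_permutes_at:
  fixes f :: "'a \<Rightarrow> real"
  assumes "finite S" "a \<in> S"
  shows "real (card S) * (\<Sum>p | p permutes S. f (p a)) = fact (card S) * sum f S"
proof -
  have "(\<Sum>p | p permutes S. f (p a)) = (\<Sum>p | p permutes S. f (p b))" if "b \<in> S" for b
    using sum_permutations_compose_right[OF permutes_swap_id[OF assms(2) that], of "\<lambda>p. f (p a)"]
    by simp
  then have "(\<Sum>b\<in>S. \<Sum>p | p permutes S. f (p a)) = (\<Sum>b\<in>S. \<Sum>p | p permutes S. f (p b))"
    by (rule sum.cong[OF refl])
  then have "real (card S) * (\<Sum>p | p permutes S. f (p a)) = (\<Sum>b\<in>S. \<Sum>p | p permutes S. f (p b))"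
    by simp
  also have "\<dots> = (\<Sum>p | p permutes S. \<Sum>b\<in>S. f (p b))"
    by (rule sum.swap)
  also have "\<dots> = fact (card S) * sum f S"
    using assms(1) by (simp add: sum_comp_permutes card_permutations)
  finally show ?thesis .
qed

theorem proposition1:
  fixes n :: nat and x :: "nat \<Rightarrow> real"
  assumes "n \<ge> 1"
    and "(\<Sum>i=1..n. x i) = 0"
  shows "1 / fact n * (\<Sum>\<sigma> | \<sigma> permutes {1..n}.
           (MAX k\<in>{1..n}. (1 / real k * (\<Sum>i=1..k. x (\<sigma> i)))\<^sup>2))
         \<le> 4 / real n * (\<Sum>i=1..n. (x i)\<^sup>2)"
proof -
  let ?P = "{p. p permutes {1..n}}"
  let ?A = "\<lambda>p. tail_max n (x \<circ> p) 1"
  \<comment> \<open>The weights in \<open>2 * a * b \<le> a * a / 2 + 2 * b * b\<close> let half of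
    the sum of squared maxima be absorbed on the left, which produces the constant 4. The mean of
    index 1 is \<open>x (p 1)\<close>.\<close>
  have "2 * (\<Sum>p\<in>?P. ?A p * \<bar>mean (x \<circ> p) 1\<bar>) \<le> (\<Sum>p\<in>?P. (?A p)\<^sup>2 / 2 + 2 * (x (p 1))\<^sup>2)"
    unfolding sum_distrib_left
  proof (rule sum_mono)
    fix p
    have "0 \<le> (?A p - 2 * \<bar>x (p 1)\<bar>)\<^sup>2"
      by simp
    then show "2 * (?A p * \<bar>mean (x \<circ> p) 1\<bar>) \<le> (?A p)\<^sup>2 / 2 + 2 * (x (p 1))\<^sup>2"
      by (simp add: mean_def power2_diff power_mult_distrib)
  qed
  with sum_tail_max_square_le[of 1 n x] assms(1)
  have A: "(\<Sum>p\<in>?P. (?A p)\<^sup>2) \<le> 4 * (\<Sum>p\<in>?P. (x (p 1))\<^sup>2)"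
    by (simp add: sum.distrib sum_distrib_left[symmetric] sum_divide_distrib[symmetric])
  have "(MAX k\<in>{1..n}. (1 / real k * (\<Sum>i=1..k. x (p i)))\<^sup>2) \<le> (?A p)\<^sup>2" for p
  proof (rule Max.boundedI)
    fix a
    assume "a \<in> (\<lambda>k. (1 / real k * (\<Sum>i=1..k. x (p i)))\<^sup>2) ` {1..n}"
    then obtain k where k: "k \<in> {1..n}" and a: "a = (mean (x \<circ> p) k)\<^sup>2"
      by (auto simp: mean_def)
    show "a \<le> (?A p)\<^sup>2"
      using power_mono[OF abs_mean_le_tail_max[of 1 k n "x \<circ> p"], of 2] k
      by (simp add: a)
  qed (use assms(1) in auto)
  then have "(\<Sum>p\<in>?P. MAX k\<in>{1..n}. (1 / real k * (\<Sum>i=1..k. x (p i)))\<^sup>2) \<le> (\<Sum>p\<in>?P. (?A p)\<^sup>2)"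
    by (rule sum_mono)
  also note A
  also have "4 * (\<Sum>p\<in>?P. (x (p 1))\<^sup>2) = fact n * (4 / real n * (\<Sum>i=1..n. (x i)\<^sup>2))"
    using sum_permutes_at[of "{1..n}" 1 "\<lambda>i. (x i)\<^sup>2"] assms(1) by (simp add: field_simps)
  finally show ?thesis
    by (simp add: field_simps)
qed

end
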